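(* Let $n\ge2$ and let $H=H(u,x^3,\dots,x^{2n})$ be a smooth function on $\mathbb{R}^{2n}$ with global coordinates $(v,u,x^3,\dots,x^{2n})$, independent of $v$. Let $h=H\,du^2+2\,dv\,du+\sum_{i=3}^{2n}(dx^i)^2$ be the corresponding Lorentzian standard pp-wave metric, let $g=h+2T^\flat\otimes T^\flat$ be its standard Riemannian dual, where $T=\tfrac12(H+1)\partial_v-\partial_u$ and $T^\flat=h(T,\cdot)$, and let $J$ be the almost complex structure determined by $JT=Z$, where $Z=\tfrac12(H-1)\partial_v-\partial_u$, and $J\partial_{x^{2k-1}}=\partial_{x^{2k}}$ for $k=2,\dots,n$ (together with $J^2=-1$), so that $(g,J)$ is almost Kähler. Then the fundamental 2-form $\omega=g(\cdot,J\cdot)$ is co-closed also with respect to the Lorentzian metric $h$ (in addition to being co-closed with respect to $g$).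
   Context: $dv\,du$ is the symmetric product, so $h(\partial_v,\partial_u)=1$, $h(\partial_u,\partial_u)=H$, $h(\partial_v,\partial_v)=0$. One has $h(T,T)=-1$. Almost Kähler means that $J$ is compatible with $g$, i.e. $g(J\cdot,J\cdot)=g$, and that $\omega$ is closed. A 2-form $\omega$ is co-closed with respect to a (pseudo-)Riemannian metric $k$ if $d( *_k\omega)=0$, where $*_k$ is the Hodge star of $k$; equivalently $\sum_i\epsilon_i(\nabla^k_{E_i}\omega)(E_i,\cdot)=0$, for $\nabla^k$ the Levi-Civita connection of $k$ and $\{E_i\}$ any local $k$-orthonormal frame with $\epsilon_i=k(E_i,E_i)=\pm1$. *)

theory Defs
  imports "HOL-Analysis.Analysis"
begin

text \<open>
  Tensor fields live on \<open>real ^ 'd\<close>. The coordinates of the text are numbered, whereas the index type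
  \<open>'d\<close> is not; a labelling \<open>c :: nat \<Rightarrow> 'd\<close>, intended to be a bijection from \<open>{1..CARD('d)}\<close>, supplies
  the numbering (and the orientation): \<open>x $ c 1\<close> is $v$, \<open>x $ c 2\<close> is $u$ and \<open>x $ c i\<close> is $x^i$ for
  $i \ge 3$. All tangent spaces are identified with \<open>real ^ 'd\<close> through the coordinate frame.
\<close>

type_synonym 'd vfield = "real ^ 'd \<Rightarrow> real ^ 'd"
type_synonym 'd metric = "real ^ 'd \<Rightarrow> real ^ 'd \<Rightarrow> real ^ 'd \<Rightarrow> real"
type_synonym 'd endo = "real ^ 'd \<Rightarrow> real ^ 'd \<Rightarrow> real ^ 'd"

text \<open>A \<open>p\<close>-form is evaluated at a point on a list of \<open>p\<close> tangent vectors.\<close>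

type_synonym 'd form = "real ^ 'd \<Rightarrow> (real ^ 'd) list \<Rightarrow> real"

definition coord_vec :: "(nat \<Rightarrow> 'd::finite) \<Rightarrow> nat \<Rightarrow> real ^ 'd" where
  "coord_vec c i = axis (c i) 1"

primrec C_k :: "nat \<Rightarrow> (real ^ 'd::finite \<Rightarrow> real) \<Rightarrow> bool" where
  "C_k 0 f \<longleftrightarrow> continuous_on UNIV f"
| "C_k (Suc k) f \<longleftrightarrow>
     (\<forall>x. f differentiable (at x)) \<and>
     (\<forall>a. C_k k (\<lambda>x. frechet_derivative f (at x) (axis a 1)))"

definition smooth :: "(real ^ 'd::finite \<Rightarrow> real) \<Rightarrow> bool" where
  "smooth f \<longleftrightarrow> (\<forall>k. C_k k f)"


subsection \<open>Exterior derivative and Hodge star\<close>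

text \<open>
  The invariant formula for the exterior derivative, evaluated on vector fields with constant
  coefficients, for which all bracket terms vanish.
\<close>

definition ext_deriv :: "('d::finite) form \<Rightarrow> 'd form" where
  "ext_deriv \<alpha> x vs =
     (\<Sum>i<length vs. (-1) ^ i *
        frechet_derivative (\<lambda>y. \<alpha> y (take i vs @ drop (Suc i) vs)) (at x) (vs ! i))"

text \<open>Smoothness is demanded because \<^const>\<open>frechet_derivative\<close> is arbitrary where no derivative exists.\<close>

definition closed_form :: "nat \<Rightarrow> ('d::finite) form \<Rightarrow> bool" where
  "closed_form p \<alpha> \<longleftrightarrow>
     (\<forall>vs. length vs = p \<longrightarrow> smooth (\<lambda>x. \<alpha> x vs)) \<and>
     (\<forall>x vs. length vs = Suc p \<longrightarrow> ext_deriv \<alpha> x vs = 0)"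

definition gram :: "('d::finite) metric \<Rightarrow> real ^ 'd \<Rightarrow> real ^ 'd ^ 'd" where
  "gram k x = (\<chi> a b. k x (axis a 1) (axis b 1))"

text \<open>
  The oriented volume form: the matrix has the vectors of the list as rows, the row with index
  \<open>c i\<close> being the \<open>i\<close>-th vector, so that the frame \<open>coord_vec c 1, \<dots>, coord_vec c CARD('d)\<close> is
  positively oriented.
\<close>

definition vol_form :: "(nat \<Rightarrow> 'd::finite) \<Rightarrow> 'd metric \<Rightarrow> 'd form" where
  "vol_form c k x vs =
     sqrt \<bar>det (gram k x)\<bar> * det (\<chi> a. vs ! (inv_into {1..CARD('d)} c a - 1))"

text \<open>
  The component $\alpha^{a_1 \dots a_p} = k^{a_1 b_1} \cdots k^{a_p b_p} \alpha_{b_1 \dots b_p}$.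
\<close>

definition raised :: "('d::finite) metric \<Rightarrow> 'd form \<Rightarrow> real ^ 'd \<Rightarrow> 'd list \<Rightarrow> real" where
  "raised k \<alpha> x as =
     (\<Sum>bs | length bs = length as.
        (\<Prod>i<length as. matrix_inv (gram k x) $ (as ! i) $ (bs ! i)) *
        \<alpha> x (map (\<lambda>b. axis b 1) bs))"

text \<open>
  $(*\alpha)_{c_1 \dots c_{m-p}} = \frac{1}{p!}\,
    \alpha^{a_1 \dots a_p}\, \mathrm{vol}_{a_1 \dots a_p c_1 \dots c_{m-p}}$, where $m$ is the dimension.
\<close>

definition hodge :: "(nat \<Rightarrow> 'd::finite) \<Rightarrow> 'd metric \<Rightarrow> nat \<Rightarrow> 'd form \<Rightarrow> 'd form" where
  "hodge c k p \<alpha> x ws =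
     (\<Sum>as | length as = p. raised k \<alpha> x as * vol_form c k x (map (\<lambda>a. axis a 1) as @ ws)) / fact p"

definition coclosed_form :: "(nat \<Rightarrow> 'd::finite) \<Rightarrow> 'd metric \<Rightarrow> nat \<Rightarrow> 'd form \<Rightarrow> bool" where
  "coclosed_form c k p \<alpha> \<longleftrightarrow> closed_form (CARD('d) - p) (hodge c k p \<alpha>)"


subsection \<open>Almost Kaehler structures\<close>

definition almost_complex :: "('d::finite) endo \<Rightarrow> bool" where
  "almost_complex J \<longleftrightarrow> (\<forall>x. linear (J x) \<and> (\<forall>X. J x (J x X) = - X))"

definition fundamental_form :: "('d::finite) metric \<Rightarrow> 'd endo \<Rightarrow> 'd form" where
  "fundamental_form g J x vs = g x (vs ! 0) (J x (vs ! 1))"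

definition almost_kaehler :: "('d::finite) metric \<Rightarrow> 'd endo \<Rightarrow> bool" where
  "almost_kaehler g J \<longleftrightarrow>
     almost_complex J \<and>
     (\<forall>x X Y. g x (J x X) (J x Y) = g x X Y) \<and>
     closed_form 2 (fundamental_form g J)"


subsection \<open>Standard pp-waves\<close>

text \<open>
  The symmetric product is normalised so that $h(\partial_v, \partial_u) = 1$ for the summand $2\,dv\,du$.
\<close>

definition pp_metric :: "(nat \<Rightarrow> 'd::finite) \<Rightarrow> (real ^ 'd \<Rightarrow> real) \<Rightarrow> 'd metric" where
  "pp_metric c H x X Y =
     H x * (X $ c 2 * Y $ c 2) + (X $ c 1 * Y $ c 2 + X $ c 2 * Y $ c 1) +
     (\<Sum>i = 3..CARD('d). X $ c i * Y $ c i)"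

definition pp_T :: "(nat \<Rightarrow> 'd::finite) \<Rightarrow> (real ^ 'd \<Rightarrow> real) \<Rightarrow> 'd vfield" where
  "pp_T c H x = ((H x + 1) / 2) *\<^sub>R coord_vec c 1 - coord_vec c 2"

definition pp_Z :: "(nat \<Rightarrow> 'd::finite) \<Rightarrow> (real ^ 'd \<Rightarrow> real) \<Rightarrow> 'd vfield" where
  "pp_Z c H x = ((H x - 1) / 2) *\<^sub>R coord_vec c 1 - coord_vec c 2"

definition riemannian_dual :: "('d::finite) metric \<Rightarrow> 'd vfield \<Rightarrow> 'd metric" where
  "riemannian_dual h T x X Y = h x X Y + 2 * (h x (T x) X * h x (T x) Y)"

end

theory Submission
  imports Defs
begin

text \<open>
  In the coordinate frame $\omega = dv \wedge du - \sum_{k=2}^n dx^{2k-1} \wedge dx^{2k}$, with constant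
  coefficients. Both $h$ and $g$ are the Euclidean metric on the $x^i$, orthogonally extended by a
  $2 \times 2$ block in the $(v,u)$-plane whose determinant $\delta$ is the constant $-1$ or $1$.
  Raising both indices of $dv \wedge du$ with such a block multiplies it by $1/\delta$, so neither the
  raised form nor the volume density depends on $H$, and $*\omega$ has constant coefficients as well.
\<close>

section \<open>Forms with constant coefficients\<close>

lemma C_k_const: "C_k k (\<lambda>x :: real ^ 'd::finite. a)"
  by (induction k arbitrary: a) (auto simp: frechet_derivative_const)

text \<open>Every function that is differentiated is constant, so it is smooth with derivative zero.
  Constancy on lists of length \<open>p\<close> suffices because \<open>ext_deriv\<close> drops one
  of its \<open>Suc p\<close> vectors.\<close>

lemma closed_form_const:
  fixes \<alpha> :: "('d::finite) form"
  assumes "\<And>x y vs. length vs = p \<Longrightarrow> \<alpha> x vs = \<alpha> y vs"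
  shows "closed_form p \<alpha>"
proof -
  have const: "(\<lambda>x. \<alpha> x vs) = (\<lambda>x. \<alpha> 0 vs)" if "length vs = p" for vs
    using assms[OF that] by (intro ext)
  have "smooth (\<lambda>x. \<alpha> x vs)" if "length vs = p" for vs
    unfolding smooth_def const[OF that] by (simp add: C_k_const)
  moreover have "ext_deriv \<alpha> x vs = 0" if "length vs = Suc p" for x vs
    unfolding ext_deriv_def
  proof (intro sum.neutral ballI)
    fix i assume "i \<in> {..<length vs}"
    then have "length (take i vs @ drop (Suc i) vs) = p"
      using that by simp
    then show "(-1) ^ i *
        frechet_derivative (\<lambda>y. \<alpha> y (take i vs @ drop (Suc i) vs)) (at x) (vs ! i) = 0"
      by (simp only: const) (simp add: frechet_derivative_const)
  qed
  ultimately show ?thesis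
    by (simp add: closed_form_def)
qed

section \<open>Matrices with a single nontrivial 2 x 2 block\<close>

text \<open>The entry \<open>p\<close> sits at (u,u) and \<open>r\<close> at (v,v). Rows are given
  as combinations of axis vectors, so that a row can be inserted directly into a bilinear
  form.\<close>

definition block_mat :: "'d \<Rightarrow> 'd \<Rightarrow> real \<Rightarrow> real \<Rightarrow> real \<Rightarrow> real ^ 'd ^ 'd::finite" where
  "block_mat v u p q r = (\<chi> a.
     if a = v then r *\<^sub>R axis v 1 + q *\<^sub>R axis u 1
     else if a = u then q *\<^sub>R axis v 1 + p *\<^sub>R axis u 1
     else axis a 1)"

text \<open>A product of symmetric blocks need not be symmetric, so the result is spelled out by
  rows and not as a \<open>block_mat\<close>.\<close>

lemma block_mat_mult:
  assumes "v \<noteq> u"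
  shows "block_mat v u p q r ** block_mat v u p' q' r' = (\<chi> a.
     if a = v then (r * r' + q * q') *\<^sub>R axis v 1 + (r * q' + q * p') *\<^sub>R axis u 1
     else if a = u then (q * r' + p * q') *\<^sub>R axis v 1 + (q * q' + p * p') *\<^sub>R axis u 1
     else axis a 1)"
proof -
  have ax: "(\<Sum>k\<in>UNIV. axis j 1 $ k * f k) = f j" for f :: "'a \<Rightarrow> real" and j
    by (simp add: axis_def if_distrib[of "\<lambda>z. z * _"] cong: if_cong)
  show ?thesis
    unfolding block_mat_def matrix_matrix_mult_def vec_eq_iff
    using assms
    by (auto simp: ax ring_distribs sum.distrib mult.assoc simp flip: sum_distrib_left)
qed

lemma matrix_inv_eqI:
  fixes A B :: "'a::semiring_1 ^ 'd ^ 'd::finite"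
  assumes "A ** B = mat 1" "B ** A = mat 1"
  shows "matrix_inv A = B"
proof -
  have "A ** matrix_inv A = mat 1"
    unfolding matrix_inv_def using assms by (rule someI2[where a = B, OF conjI]) simp
  then have "B ** A ** matrix_inv A = B"
    by (simp flip: matrix_mul_assoc)
  then show ?thesis
    by (simp add: assms(2))
qed

lemma matrix_inv_block_mat:
  assumes "v \<noteq> u" and \<delta>: "p * r - q * q = \<delta>" "\<delta> \<noteq> 0"
  shows "matrix_inv (block_mat v u p q r) = block_mat v u (r / \<delta>) (- q / \<delta>) (p / \<delta>)"
proof -
  have "block_mat v u p q r ** block_mat v u (r / \<delta>) (- q / \<delta>) (p / \<delta>) = mat 1"
       "block_mat v u (r / \<delta>) (- q / \<delta>) (p / \<delta>) ** block_mat v u p q r = mat 1"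
    using \<delta> assms(1)
    by (auto simp: block_mat_mult mat_def axis_def vec_eq_iff field_simps)
  then show ?thesis
    by (rule matrix_inv_eqI)
qed

text \<open>In the Leibniz sum only the identity and the transposition of \<open>v\<close> and
  \<open>u\<close> survive; they contribute \<open>p * r\<close> and \<open>- q * q\<close>.\<close>

lemma det_block_mat:
  fixes v u :: "'d::finite"
  assumes "v \<noteq> u"
  shows "det (block_mat v u p q r) = p * r - q * q"
proof -
  let ?B = "block_mat v u p q r" and ?s = "Transposition.transpose v u"
  have zero: "of_int (sign \<pi>) * (\<Prod>a\<in>UNIV. ?B $ a $ \<pi> a) = 0"
    if "\<pi> permutes UNIV" "\<pi> \<noteq> id" "\<pi> \<noteq> ?s" for \<pi>
  proof -
    have "\<exists>a. ?B $ a $ \<pi> a = 0"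
    proof (rule ccontr)
      \<comment> \<open>Outside the block the only nonzero entry of a row is the diagonal one, so a
        nonvanishing product forces \<open>\<pi>\<close> to fix every other index and to preserve
        \<open>{v, u}\<close>. This leaves just the two excluded permutations.\<close>
      assume "\<not> ?thesis"
      then have nz: "?B $ a $ \<pi> a \<noteq> 0" for a by auto
      have fixed: "\<pi> a = a" if "a \<noteq> v" "a \<noteq> u" for a
        using nz[of a] that by (auto simp: block_mat_def axis_def split: if_splits)
      have vu: "\<pi> a \<in> {v, u}" if "a \<in> {v, u}" for a
        using nz[of a] that by (auto simp: block_mat_def axis_def split: if_splits)
      have "inj \<pi>" using that(1) by (simp add: permutes_inj)
      then have "\<pi> v \<noteq> \<pi> u" using assms by (auto dest: injD)
      then consider "\<pi> v = v" "\<pi> u = u" | "\<pi> v = u" "\<pi> u = v"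
        using vu[of v] vu[of u] by auto
      then show False
      proof cases
        case 1
        then have "\<pi> = id" using fixed by (metis eq_id_iff)
        then show False using that by simp
      next
        case 2
        then have "\<pi> = ?s" using fixed by (auto simp: Transposition.transpose_def)
        then show False using that by simp
      qed
    qed
    then show ?thesis by auto
  qed
  have prod: "(\<Prod>a\<in>UNIV. f a) = f v * f u" if "\<And>a. a \<noteq> v \<Longrightarrow> a \<noteq> u \<Longrightarrow> f a = 1"
    for f :: "'d \<Rightarrow> real"
  proof -
    have "(\<Prod>a\<in>UNIV. f a) = (\<Prod>a\<in>{v, u}. f a)"
      using that by (intro prod.mono_neutral_right) auto
    then show ?thesis using assms by simp
  qed
  have ne: "id \<noteq> ?s" using assms by (metis id_apply Transposition.transpose_apply_first)
  have "det ?B = (\<Sum>\<pi>\<in>{id, ?s}. of_int (sign \<pi>) * (\<Prod>a\<in>UNIV. ?B $ a $ \<pi> a))"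
    unfolding det_def
    by (intro sum.mono_neutral_right) (auto simp: zero permutes_id permutes_swap_id finite_permutations)
  also have "\<dots> = (\<Prod>a\<in>UNIV. ?B $ a $ a) - (\<Prod>a\<in>UNIV. ?B $ a $ ?s a)"
    using ne assms by (simp add: sign_swap_id)
  also have "\<dots> = p * r - q * q"
    using assms by (subst (1 2) prod) (auto simp: block_mat_def axis_def Transposition.transpose_def)
  finally show ?thesis .
qed

section \<open>Index raising and the Hodge star for block metrics\<close>

text \<open>The sum over index lists of length 2 is a double sum; bilinearity moves it into the
  arguments, where it reassembles rows \<open>a\<close> and \<open>b\<close> of the inverse Gram
  matrix.\<close>

lemma raised_two:
  fixes \<alpha> :: "('d::finite) form"
  assumes "bilinear \<omega>" and "\<And>vs. \<alpha> x vs = \<omega> (vs ! 0) (vs ! 1)"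
  shows "raised k \<alpha> x [a, b] = \<omega> (matrix_inv (gram k x) $ a) (matrix_inv (gram k x) $ b)"
proof -
  let ?N = "matrix_inv (gram k x)"
  have lists: "{bs :: 'd list. length bs = 2} = (\<lambda>(s, t). [s, t]) ` (UNIV \<times> UNIV)"
    by (auto simp: length_Suc_conv numeral_2_eq_2 image_iff)
  have "raised k \<alpha> x [a, b] =
      (\<Sum>(s, t)\<in>UNIV \<times> UNIV. ?N $ a $ s * ?N $ b $ t * \<omega> (axis s 1) (axis t 1))"
    unfolding raised_def using lists
    by (simp add: numeral_2_eq_2 assms(2))
       (subst sum.reindex, auto intro!: inj_onI sum.cong simp: lessThan_Suc)
  also have "\<dots> = \<omega> (\<Sum>s\<in>UNIV. ?N $ a $ s *\<^sub>R axis s 1) (\<Sum>t\<in>UNIV. ?N $ b $ t *\<^sub>R axis t 1)"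
    using assms(1)
    by (simp add: bilinear_sum bilinear_lmul bilinear_rmul case_prod_unfold mult.assoc)
  finally show ?thesis
    by (simp add: basis_expansion flip: scalar_mult_eq_scaleR)
qed

text \<open>On the (v,u)-plane an alternating form is a multiple of the area form, so raising both
  indices scales it by the determinant of the inverse block, \<open>1 / \<delta>\<close>. Mixed
  components vanish by \<open>ortho\<close>, and elsewhere the inverse is the identity. With the
  density \<open>sqrt \<bar>\<delta>\<bar>\<close> also constant, the Hodge star has constant
  coefficients.\<close>

lemma coclosed_form_block:
  fixes c :: "nat \<Rightarrow> 'd::finite" and \<alpha> :: "'d form"
  assumes gram: "\<And>x. gram k x = block_mat v u (p x) (q x) (r x)"
    and det: "\<And>x. p x * r x - q x * q x = \<delta>" "\<delta> \<noteq> 0"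
    and vu: "v \<noteq> u"
    and bil: "bilinear \<omega>"
    and \<alpha>: "\<And>x vs. \<alpha> x vs = \<omega> (vs ! 0) (vs ! 1)"
    and alt: "\<And>X. \<omega> X X = 0"
    and ortho: "\<And>a w. a \<notin> {v, u} \<Longrightarrow> w \<in> {v, u} \<Longrightarrow> \<omega> (axis w 1) (axis a 1) = 0"
  shows "coclosed_form c k 2 \<alpha>"
proof -
  have skew: "\<omega> X Y = - \<omega> Y X" for X Y
    using alt[of "X + Y"] alt[of X] alt[of Y] bilinear_ladd[OF bil] bilinear_radd[OF bil] by simp
  have "raised k \<alpha> x [a, b] =
      (if a \<in> {v, u} \<and> b \<in> {v, u} then 1 / \<delta> else 1) * \<omega> (axis a 1) (axis b 1)" for x a b
  proof -
    let ?t = "\<omega> (axis v 1) (axis u 1)"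
    \<comment> \<open>This says that the inverse block has determinant \<open>1 / \<delta>\<close>,
      with products nested as they arise when the bilinear form is expanded below.\<close>
    have "p x * (r x * ?t) / (\<delta> * \<delta>) = ?t / \<delta> + q x * (q x * ?t) / (\<delta> * \<delta>)"
    proof -
      have "?t / \<delta> = (p x * r x - q x * q x) * ?t / (\<delta> * \<delta>)"
        using det by simp
      then show ?thesis by (simp add: diff_divide_distrib left_diff_distrib mult.assoc)
    qed
    moreover have "\<omega> (axis u 1) (axis v 1) = - \<omega> (axis v 1) (axis u 1)"
      by (rule skew)
    moreover have "\<omega> (axis a 1) (axis w 1) = 0" if "a \<notin> {v, u}" "w \<in> {v, u}" for a w
      using ortho[OF that] skew[of "axis a 1" "axis w 1"] by simp
    ultimately show ?thesis
      unfolding raised_two[where \<omega> = \<omega>, OF bil \<alpha>] gram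
      unfolding matrix_inv_block_mat[OF vu det(1)[of x] det(2)]
      unfolding block_mat_def
      using vu ortho alt
      by (auto simp: bilinear_ladd[OF bil] bilinear_radd[OF bil] bilinear_lmul[OF bil]
          bilinear_rmul[OF bil] bilinear_lneg[OF bil] bilinear_rneg[OF bil]
          bilinear_lsub[OF bil] bilinear_rsub[OF bil] diff_divide_distrib algebra_simps)
  qed
  then have "raised k \<alpha> x as = raised k \<alpha> y as" if "length as = 2" for x y as
    using that by (auto simp: length_Suc_conv numeral_2_eq_2)
  moreover have "vol_form c k x ws = vol_form c k y ws" for x y ws
    by (simp add: vol_form_def gram det_block_mat[OF vu] det)
  ultimately have "hodge c k 2 \<alpha> x ws = hodge c k 2 \<alpha> y ws" for x y ws
    unfolding hodge_def
    by (intro arg_cong2[of _ _ _ _ "(/)"] sum.cong arg_cong2[of _ _ _ _ "(*)"]) auto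
  then show ?thesis
    unfolding coclosed_form_def by (intro closed_form_const)
qed

section \<open>The standard symplectic form\<close>

lemma sum_pairs:
  fixes f :: "nat \<Rightarrow> 'a::comm_monoid_add"
  shows "(\<Sum>i = 3..2 * n. f i) = (\<Sum>k = 2..n. f (2 * k - 1) + f (2 * k))"
proof (induction n)
  case (Suc n)
  show ?case
  \<comment> \<open>For \<open>n = 0\<close> the step would add the indices 1 and 2, which lie below
    the lower bound 3; both sums are then empty.\<close>
  proof (cases "n = 0")
    case False
    then have "{3..2 * Suc n} = insert (2 * n + 1) (insert (2 * n + 2) {3..2 * n})"
      by auto
    then show ?thesis
      using Suc False by (simp add: ac_simps)
  qed simp
qed simp

text \<open>This is dv \<and> du minus the sum of the dx^{2k-1} \<and> dx^{2k}. The minus sign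
  arises because \<open>J\<close> stands in the second slot of the fundamental form.\<close>

definition std_symp :: "(nat \<Rightarrow> 'd::finite) \<Rightarrow> nat \<Rightarrow> real ^ 'd \<Rightarrow> real ^ 'd \<Rightarrow> real" where
  "std_symp c n X Y = X $ c 1 * Y $ c 2 - X $ c 2 * Y $ c 1 +
     (\<Sum>k = 2..n. X $ c (2 * k) * Y $ c (2 * k - 1) - X $ c (2 * k - 1) * Y $ c (2 * k))"

lemma bilinear_std_symp: "bilinear (std_symp c n)"
  unfolding bilinear_def std_symp_def
  by (auto intro!: linearI simp: algebra_simps sum.distrib sum_subtractf sum_distrib_left)

section \<open>Coordinates and Gram matrices of the two metrics\<close>

context
  fixes n :: nat and c :: "nat \<Rightarrow> 'd::finite" and H :: "real ^ 'd \<Rightarrow> real"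
  assumes n: "n \<ge> 2" and card: "CARD('d) = 2 * n" and bij: "bij_betw c {1..2 * n} UNIV"
begin

lemma label_eq_iff: "i \<in> {1..2 * n} \<Longrightarrow> j \<in> {1..2 * n} \<Longrightarrow> c i = c j \<longleftrightarrow> i = j"
  by (rule inj_on_eq_iff[OF bij_betw_imp_inj_on[OF bij]])

lemma coord_vec_nth:
  "i \<in> {1..2 * n} \<Longrightarrow> j \<in> {1..2 * n} \<Longrightarrow> coord_vec c i $ c j = (if i = j then 1 else 0)"
  using label_eq_iff[of j i] by (auto simp: coord_vec_def axis_def)

text \<open>Parity separates the two families of labels; the bounds on \<open>k\<close> and
  \<open>l\<close> keep the natural subtraction from truncating.\<close>

lemma coord_vec_pair_nth:
  assumes "k \<in> {2..n}" "l \<in> {2..n}"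
  shows "coord_vec c (2 * k) $ c (2 * l) = (if k = l then 1 else 0)"
    and "coord_vec c (2 * k - 1) $ c (2 * l - 1) = (if k = l then 1 else 0)"
    and "coord_vec c (2 * k) $ c (2 * l - 1) = 0"
    and "coord_vec c (2 * k - 1) $ c (2 * l) = 0"
proof -
  have mem: "2 * k \<in> {1..2 * n}" "2 * l \<in> {1..2 * n}"
      "2 * k - 1 \<in> {1..2 * n}" "2 * l - 1 \<in> {1..2 * n}"
    and eq: "2 * k - 1 = 2 * l - 1 \<longleftrightarrow> k = l" "2 * k \<noteq> 2 * l - 1" "2 * k - 1 \<noteq> 2 * l"
    using assms by (auto, presburger+)
  show "coord_vec c (2 * k) $ c (2 * l) = (if k = l then 1 else 0)"
    and "coord_vec c (2 * k - 1) $ c (2 * l - 1) = (if k = l then 1 else 0)"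
    and "coord_vec c (2 * k) $ c (2 * l - 1) = 0"
    and "coord_vec c (2 * k - 1) $ c (2 * l) = 0"
    using mem eq by (simp_all add: coord_vec_nth del: One_nat_def)
qed

text \<open>The dual covector of T is (1 - H)/2 du - dv; adding twice its square to h gives these
  coefficients.\<close>

lemma riemannian_dual_pp:
  "riemannian_dual (pp_metric c H) (pp_T c H) x X Y =
     (1 + H x ^ 2) / 2 * (X $ c 2 * Y $ c 2) + H x * (X $ c 1 * Y $ c 2 + X $ c 2 * Y $ c 1) +
     2 * (X $ c 1 * Y $ c 1) + (\<Sum>i = 3..CARD('d). X $ c i * Y $ c i)"
proof -
  have T: "pp_metric c H x (pp_T c H x) X = (1 - H x) / 2 * X $ c 2 - X $ c 1" for X
  proof -
    have "(\<Sum>i = 3..CARD('d). pp_T c H x $ c i * X $ c i) = 0"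
      using n card by (intro sum.neutral) (auto simp: pp_T_def coord_vec_nth)
    then show ?thesis
      using n by (simp add: pp_metric_def) (simp add: pp_T_def coord_vec_nth field_simps)
  qed
  show ?thesis
    unfolding riemannian_dual_def T by (simp add: pp_metric_def field_simps power2_eq_square)
qed

lemma label_outside: "a \<notin> {c 1, c 2} \<Longrightarrow> \<exists>i\<in>{3..2 * n}. a = c i"
proof -
  assume a: "a \<notin> {c 1, c 2}"
  obtain i where i: "i \<in> {1..2 * n}" "a = c i"
    using bij unfolding bij_betw_def by blast
  then have "i \<noteq> 1" "i \<noteq> 2" using a by auto
  then show ?thesis using i by force
qed

text \<open>The labelling maps \<open>{3..2 * n}\<close> bijectively onto the complement of
  \<open>{c 1, c 2}\<close>, so the Euclidean part contributes the identity matrix there.\<close>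

lemma sum_axis_outside:
  "(\<Sum>i = 3..CARD('d). axis a 1 $ c i * axis b 1 $ c i) =
     (if a = b \<and> a \<notin> {c 1, c 2} then 1 else 0 :: real)"
proof -
  have "bij_betw c {3..2 * n} (- {c 1, c 2})"
    unfolding bij_betw_def
  proof
    show "inj_on c {3..2 * n}"
      using bij by (rule inj_on_subset[OF bij_betw_imp_inj_on]) auto
    have "c i \<notin> {c 1, c 2}" if "i \<in> {3..2 * n}" for i
      using that n label_eq_iff[of i 1] label_eq_iff[of i 2] by auto
    then have "c ` {3..2 * n} \<subseteq> - {c 1, c 2}"
      unfolding image_subset_iff Compl_iff by (rule ballI)
    moreover have "- {c 1, c 2} \<subseteq> c ` {3..2 * n}"
      using label_outside by (intro subsetI) (simp only: Compl_iff image_iff)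
    ultimately show "c ` {3..2 * n} = - {c 1, c 2}"
      by (rule subset_antisym)
  qed
  then have "(\<Sum>i = 3..CARD('d). axis a 1 $ c i * axis b 1 $ c i) =
      (\<Sum>d\<in>- {c 1, c 2}. axis a 1 $ d * axis b 1 $ d :: real)"
    unfolding card by (rule sum.reindex_bij_betw)
  also have "\<dots> = (\<Sum>d\<in>- {c 1, c 2}. if d = a then if a = b then 1 else 0 else 0)"
    by (intro sum.cong) (auto simp: axis_def)
  finally show ?thesis
    by (simp only: sum.delta finite) auto
qed

lemma labels_neq: "c 1 \<noteq> c 2"
  using n label_eq_iff[of 1 2] by simp

lemma gram_pp_metric: "gram (pp_metric c H) x = block_mat (c 1) (c 2) (H x) 1 0"
  unfolding gram_def pp_metric_def sum_axis_outside
  using labels_neq by (auto simp: block_mat_def vec_eq_iff axis_def)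

lemma gram_riemannian_dual:
  "gram (riemannian_dual (pp_metric c H) (pp_T c H)) x =
     block_mat (c 1) (c 2) ((1 + H x ^ 2) / 2) (H x) 2"
  unfolding gram_def riemannian_dual_pp sum_axis_outside
  using labels_neq by (auto simp: block_mat_def vec_eq_iff axis_def)

lemma coclosed_std_symp:
  assumes "\<And>x. gram k x = block_mat (c 1) (c 2) (p x) (q x) (r x)"
    and "\<And>x. p x * r x - q x * q x = \<delta>" "\<delta> \<noteq> 0"
    and \<alpha>: "\<And>x vs. \<alpha> x vs = std_symp c n (vs ! 0) (vs ! 1)"
  shows "coclosed_form c k 2 \<alpha>"
proof (rule coclosed_form_block[OF assms(1-3) labels_neq bilinear_std_symp \<alpha>])
  show "std_symp c n X X = 0" for X
    by (simp add: std_symp_def mult.commute)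
  show "std_symp c n (axis w 1) (axis a 1) = 0" if "a \<notin> {c 1, c 2}" "w \<in> {c 1, c 2}" for a w
  proof -
    \<comment> \<open>Each term of the sum over pairs contains a coordinate of
      \<open>axis w 1\<close> with label at least 3, so the whole sum vanishes.\<close>
    have zero: "axis w 1 $ c i = (0::real)" if "i \<in> {3..2 * n}" for i
      using that \<open>w \<in> {c 1, c 2}\<close> n label_eq_iff[of i 1] label_eq_iff[of i 2] by (auto simp: axis_def)
    have "(\<Sum>k = 2..n. axis w 1 $ c (2 * k) * axis a 1 $ c (2 * k - 1) -
        axis w 1 $ c (2 * k - 1) * axis a 1 $ c (2 * k)) = (0::real)"
    proof (intro sum.neutral ballI)
      fix k assume "k \<in> {2..n}"
      then have "2 * k \<in> {3..2 * n}" "2 * k - 1 \<in> {3..2 * n}" by auto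
      then show "axis w 1 $ c (2 * k) * axis a 1 $ c (2 * k - 1) -
          axis w 1 $ c (2 * k - 1) * axis a 1 $ c (2 * k) = (0::real)"
        by (simp add: zero del: One_nat_def)
    qed
    moreover have "axis a 1 $ c 1 = (0::real)" "axis a 1 $ c 2 = (0::real)"
      using that by (auto simp: axis_def)
    ultimately show ?thesis by (simp add: std_symp_def)
  qed
qed

section \<open>The almost complex structure and its fundamental form\<close>

context
  fixes J :: "'d endo"
  assumes J: "almost_complex J"
    and JT: "\<And>x. J x (pp_T c H x) = pp_Z c H x"
    and Jk: "\<And>x k. k \<in> {2..n} \<Longrightarrow> J x (coord_vec c (2 * k - 1)) = coord_vec c (2 * k)"
begin

text \<open>The prescribed values determine \<open>J\<close>: T and Z span the (v,u)-plane, and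
  \<open>J\<^sup>2 = -1\<close> supplies the images of Z and of the even coordinate vectors.\<close>

lemma J_expansion:
  "J x Y = (H x * Y $ c 1 + (1 + H x ^ 2) / 2 * Y $ c 2) *\<^sub>R coord_vec c 1 -
     (2 * Y $ c 1 + H x * Y $ c 2) *\<^sub>R coord_vec c 2 +
     (\<Sum>k = 2..n. Y $ c (2 * k - 1) *\<^sub>R coord_vec c (2 * k) -
       Y $ c (2 * k) *\<^sub>R coord_vec c (2 * k - 1))"
proof -
  interpret J: linear "J x" using J by (simp add: almost_complex_def)
  have sq: "J x (J x X) = - X" for X using J by (simp add: almost_complex_def)
  let ?e = "coord_vec c"
  \<comment> \<open>The coefficients (H + 1)/2 and (H - 1)/2 differ by exactly 1.\<close>
  have e1: "?e 1 = pp_T c H x - pp_Z c H x"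
    by (simp add: pp_T_def pp_Z_def flip: scaleR_diff_left) (simp add: field_simps)
  have e2: "?e 2 = ((H x + 1) / 2) *\<^sub>R ?e 1 - pp_T c H x"
    by (simp add: pp_T_def)
  have JZ: "J x (pp_Z c H x) = - pp_T c H x"
    using sq[of "pp_T c H x"] by (simp add: JT)
  have J1: "J x (?e 1) = H x *\<^sub>R ?e 1 - 2 *\<^sub>R ?e 2"
    by (subst e1) (simp add: J.diff JT JZ, simp add: pp_T_def pp_Z_def vec_eq_iff field_simps)
  have J2: "J x (?e 2) = ((1 + H x ^ 2) / 2) *\<^sub>R ?e 1 - H x *\<^sub>R ?e 2"
    by (subst e2) (simp only: J.diff J.scale J1 JT,
        simp add: pp_Z_def vec_eq_iff field_simps power2_eq_square)
  have Jeven: "J x (?e (2 * k)) = - ?e (2 * k - 1)" if "k \<in> {2..n}" for k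
    using sq[of "?e (2 * k - 1)"] Jk[OF that] by simp
  have "Y = (\<Sum>a\<in>UNIV. Y $ a *\<^sub>R axis a 1)"
    using basis_expansion[of Y] by (simp add: scalar_mult_eq_scaleR)
  also have "\<dots> = (\<Sum>i = 1..2 * n. Y $ c i *\<^sub>R ?e i)"
    unfolding coord_vec_def by (rule sum.reindex_bij_betw[OF bij, symmetric])
  also have "{1..2 * n} = insert 1 (insert 2 {3..2 * n})"
    using n by auto
  finally have "Y = Y $ c 1 *\<^sub>R ?e 1 + (Y $ c 2 *\<^sub>R ?e 2 + (\<Sum>i = 3..2 * n. Y $ c i *\<^sub>R ?e i))"
    by simp
  then have "J x Y = J x (Y $ c 1 *\<^sub>R ?e 1 + (Y $ c 2 *\<^sub>R ?e 2 +
      (\<Sum>k = 2..n. Y $ c (2 * k - 1) *\<^sub>R ?e (2 * k - 1) + Y $ c (2 * k) *\<^sub>R ?e (2 * k))))"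
    by (simp only: sum_pairs)
  also have "\<dots> = Y $ c 1 *\<^sub>R J x (?e 1) + (Y $ c 2 *\<^sub>R J x (?e 2) +
      (\<Sum>k = 2..n. Y $ c (2 * k - 1) *\<^sub>R J x (?e (2 * k - 1)) + Y $ c (2 * k) *\<^sub>R J x (?e (2 * k))))"
    by (simp add: J.add J.scale J.sum)
  also have "(\<Sum>k = 2..n. Y $ c (2 * k - 1) *\<^sub>R J x (?e (2 * k - 1)) +
        Y $ c (2 * k) *\<^sub>R J x (?e (2 * k))) =
      (\<Sum>k = 2..n. Y $ c (2 * k - 1) *\<^sub>R ?e (2 * k) - Y $ c (2 * k) *\<^sub>R ?e (2 * k - 1))"
    using Jk Jeven by (intro sum.cong) auto
  finally show ?thesis
    unfolding J1 J2 by (simp add: algebra_simps)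
qed

lemma J_nth:
  "J x Y $ c 1 = H x * Y $ c 1 + (1 + H x ^ 2) / 2 * Y $ c 2"
  "J x Y $ c 2 = - (2 * Y $ c 1 + H x * Y $ c 2)"
  "k \<in> {2..n} \<Longrightarrow> J x Y $ c (2 * k) = Y $ c (2 * k - 1)"
  "k \<in> {2..n} \<Longrightarrow> J x Y $ c (2 * k - 1) = - Y $ c (2 * k)"
proof -
  \<comment> \<open>Coordinate vectors with label at least 3 have no v- or u-component.\<close>
  have 0: "(\<Sum>l = 2..n. Y $ c (2 * l - 1) * coord_vec c (2 * l) $ c i -
        Y $ c (2 * l) * coord_vec c (2 * l - 1) $ c i) = 0" if "i \<in> {1, 2}" for i
  proof (intro sum.neutral ballI)
    fix l assume "l \<in> {2..n}"
    then have "2 * l - 1 \<in> {1..2 * n}" "2 * l \<in> {1..2 * n}" "i \<in> {1..2 * n}"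
      "2 * l - 1 \<noteq> i" "2 * l \<noteq> i"
      using that by auto
    then show "Y $ c (2 * l - 1) * coord_vec c (2 * l) $ c i -
        Y $ c (2 * l) * coord_vec c (2 * l - 1) $ c i = 0"
      by (simp add: coord_vec_nth del: One_nat_def)
  qed
  show "J x Y $ c 1 = H x * Y $ c 1 + (1 + H x ^ 2) / 2 * Y $ c 2"
       "J x Y $ c 2 = - (2 * Y $ c 1 + H x * Y $ c 2)"
    unfolding J_expansion using n 0[of 1] 0[of 2] by (simp_all add: coord_vec_nth)
  assume k: "k \<in> {2..n}"
  have ends: "coord_vec c 1 $ c (2 * k) = 0" "coord_vec c 2 $ c (2 * k) = 0"
    "coord_vec c 1 $ c (2 * k - 1) = 0" "coord_vec c 2 $ c (2 * k - 1) = 0"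
  proof -
    have "2 * k \<in> {1..2 * n}" "2 * k - 1 \<in> {1..2 * n}" "1 \<in> {1..2 * n}" "2 \<in> {1..2 * n}"
      "1 \<noteq> 2 * k" "2 \<noteq> 2 * k" "1 \<noteq> 2 * k - 1" "2 \<noteq> 2 * k - 1"
      using k n by auto
    then show "coord_vec c 1 $ c (2 * k) = 0" "coord_vec c 2 $ c (2 * k) = 0"
      "coord_vec c 1 $ c (2 * k - 1) = 0" "coord_vec c 2 $ c (2 * k - 1) = 0"
      by (simp_all only: coord_vec_nth if_False)
  qed
  have "(\<Sum>l = 2..n. Y $ c (2 * l - 1) * coord_vec c (2 * l) $ c (2 * k) -
        Y $ c (2 * l) * coord_vec c (2 * l - 1) $ c (2 * k)) =
      (\<Sum>l = 2..n. if l = k then Y $ c (2 * k - 1) else 0)"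
    using k by (intro sum.cong[OF refl]) (simp add: coord_vec_pair_nth del: One_nat_def)
  then show "J x Y $ c (2 * k) = Y $ c (2 * k - 1)"
    unfolding J_expansion using k ends(1,2) by (simp del: One_nat_def)
  have "(\<Sum>l = 2..n. Y $ c (2 * l - 1) * coord_vec c (2 * l) $ c (2 * k - 1) -
        Y $ c (2 * l) * coord_vec c (2 * l - 1) $ c (2 * k - 1)) =
      (\<Sum>l = 2..n. if l = k then - Y $ c (2 * k) else 0)"
    using k by (intro sum.cong[OF refl]) (simp add: coord_vec_pair_nth del: One_nat_def)
  then show "J x Y $ c (2 * k - 1) = - Y $ c (2 * k)"
    unfolding J_expansion using k ends(3,4) by (simp del: One_nat_def)
qed

lemma fundamental_form_pp:
  "fundamental_form (riemannian_dual (pp_metric c H) (pp_T c H)) J x vs =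
     std_symp c n (vs ! 0) (vs ! 1)"
proof -
  \<comment> \<open>Here \<open>t\<close> stands for \<open>H x\<close>. The coefficient of
    \<open>X1 * Y2\<close> is \<open>- t\<^sup>2 + (1 + t\<^sup>2) = 1\<close>; all dependence on
    \<open>H\<close> cancels in this way.\<close>
  have block: "(1 + t\<^sup>2) / 2 * (X2 * - (2 * Y1 + t * Y2)) +
      t * (X1 * - (2 * Y1 + t * Y2) + X2 * (t * Y1 + (1 + t\<^sup>2) / 2 * Y2)) +
      2 * (X1 * (t * Y1 + (1 + t\<^sup>2) / 2 * Y2)) = X1 * Y2 - X2 * Y1" for t X1 X2 Y1 Y2 :: real
    by (simp add: field_simps power2_eq_square)
  have "(\<Sum>i = 3..CARD('d). X $ c i * J x Y $ c i) =
      (\<Sum>k = 2..n. X $ c (2 * k) * Y $ c (2 * k - 1) - X $ c (2 * k - 1) * Y $ c (2 * k))" for X Y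
    unfolding card sum_pairs by (intro sum.cong[OF refl]) (simp add: J_nth del: One_nat_def)
  then show ?thesis
    unfolding fundamental_form_def riemannian_dual_pp std_symp_def J_nth(1,2)
    by (simp only: block)
qed

lemma riemannian_dual_compatible:
  fixes x X Y :: "real ^ 'd"
  defines "g \<equiv> riemannian_dual (pp_metric c H) (pp_T c H)"
  shows "g x (J x X) (J x Y) = g x X Y"
proof -
  have block: "K * (- (2 * X1 + t * X2) * - (2 * Y1 + t * Y2)) +
      t * ((t * X1 + K * X2) * - (2 * Y1 + t * Y2) + - (2 * X1 + t * X2) * (t * Y1 + K * Y2)) +
      2 * ((t * X1 + K * X2) * (t * Y1 + K * Y2)) =
      K * (X2 * Y2) + t * (X1 * Y2 + X2 * Y1) + 2 * (X1 * Y1)" (is "?l = ?r")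
    if "K = (1 + t\<^sup>2) / 2" for K t X1 X2 Y1 Y2 :: real
  proof -
    \<comment> \<open>The second factor is \<open>?r\<close> itself and
      \<open>2 * K - t\<^sup>2\<close> is the determinant of the block of \<open>g\<close>:
      composing both arguments with \<open>J\<close> multiplies the block by this determinant, which
      is 1.\<close>
    have "?l - ?r = (2 * K - t\<^sup>2 - 1) * (2 * (X1 * Y1) + t * (X1 * Y2 + X2 * Y1) + K * (X2 * Y2))"
      by (simp add: algebra_simps power2_eq_square)
    also have "2 * K - t\<^sup>2 - 1 = 0" using that by simp
    finally show ?thesis by simp
  qed
  have "(\<Sum>i = 3..CARD('d). J x X $ c i * J x Y $ c i) = (\<Sum>i = 3..CARD('d). X $ c i * Y $ c i)"
    unfolding card sum_pairs by (intro sum.cong[OF refl]) (simp add: J_nth del: One_nat_def)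
  then show ?thesis
    unfolding g_def riemannian_dual_pp J_nth(1,2) by (simp only: block[OF refl])
qed

end

end

theorem corollary3:
  fixes n :: nat
    and c :: "nat \<Rightarrow> 'd::finite"
    and H :: "real ^ 'd \<Rightarrow> real"
    and J :: "real ^ 'd \<Rightarrow> real ^ 'd \<Rightarrow> real ^ 'd"
    and h g :: "real ^ 'd \<Rightarrow> real ^ 'd \<Rightarrow> real ^ 'd \<Rightarrow> real"
  assumes "n \<ge> 2"
    and "CARD('d) = 2 * n"
    and "bij_betw c {1..2 * n} UNIV"
    and "smooth H"
    and "\<forall>x t. H (x + t *\<^sub>R coord_vec c 1) = H x"
    and "h = pp_metric c H"
    and "g = riemannian_dual h (pp_T c H)"
    and "almost_complex J"
    and "\<forall>x. J x (pp_T c H x) = pp_Z c H x"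
    and "\<forall>x. \<forall>k\<in>{2..n}. J x (coord_vec c (2 * k - 1)) = coord_vec c (2 * k)"
  shows "almost_kaehler g J \<and>
    coclosed_form c h 2 (fundamental_form g J) \<and>
    coclosed_form c g 2 (fundamental_form g J)"
proof -
  let ?\<omega> = "fundamental_form g J"
  note ctx = assms(1-3)
  have JT: "\<And>x. J x (pp_T c H x) = pp_Z c H x"
    and Jk: "\<And>x k. k \<in> {2..n} \<Longrightarrow> J x (coord_vec c (2 * k - 1)) = coord_vec c (2 * k)"
    using assms(9,10) by auto
  have \<omega>: "?\<omega> x vs = std_symp c n (vs ! 0) (vs ! 1)" for x vs
    unfolding assms(6,7) by (rule fundamental_form_pp[OF ctx assms(8) JT Jk])
  \<comment> \<open>Closedness follows because \<open>\<omega>\<close> expresses the form through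
    \<open>std_symp\<close>, which does not involve the point.\<close>
  have "almost_kaehler g J"
    unfolding almost_kaehler_def
    using assms(8) riemannian_dual_compatible[OF ctx assms(8) JT Jk] \<omega>
    by (auto simp: assms(6,7) intro!: closed_form_const)
  moreover have "coclosed_form c h 2 ?\<omega>"
    unfolding assms(6)
    \<comment> \<open>The block of \<open>h\<close> has entries \<open>H x\<close>, 1, 0, so its
      determinant is -1.\<close>
    by (rule coclosed_std_symp[OF ctx gram_pp_metric[OF ctx] _ _ \<omega>, where \<delta> = "-1"]) auto
  moreover have "coclosed_form c g 2 ?\<omega>"
    \<comment> \<open>For \<open>g\<close> the determinant is
      \<open>2 * ((1 + H x ^ 2) / 2) - H x ^ 2 = 1\<close>.\<close>
    by (rule coclosed_std_symp[OF ctx _ _ _ \<omega>, where \<delta> = 1])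
       (auto simp: assms(6,7) gram_riemannian_dual[OF ctx] power2_eq_square add_divide_distrib)
  ultimately show ?thesis by blast
qed

end
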